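(* Let $1\le k\le n$ and let $a_1,\dots,a_k,b_1,\dots,b_k$ be nonnegative integers with $\sum_{i=1}^k i(a_i+b_i)=k$. Then the number of $k$-permutations of $[n]$ of cycle type $1^{a_1}2^{a_2}\cdots k^{a_k}1'^{b_1}2'^{b_2}\cdots k'^{b_k}$ equals $$\frac{k!}{\prod_{i=1}^k \left(i^{a_i}\,a_i!\,b_i!\right)}\,(n-k)_s,$$ where $s=b_1+\cdots+b_k$.
   Context: $[\ell]=\{1,\dots,\ell\}$. A $k$-permutation of $[n]$ is an injective map $\pi:[k]\to[n]$. A cycle of $\pi$ of length $\ell$ is a sequence of distinct $u_1,\dots,u_\ell\in[k]$ (up to rotation) with $\pi(u_t)=u_{t+1}$ for $t<\ell$ and $\pi(u_\ell)=u_1$; a path of $\pi$ of length $\ell$ is a sequence of distinct $u_1,\dots,u_\ell\in[k]$ with $\pi(u_t)=u_{t+1}$ for $t<\ell$ and $\pi(u_\ell)=v$ for some $v\notin[k]$. Every $k$-permutation decomposes uniquely into disjoint cycles and paths whose elements in $[k]$ partition $[k]$. The cycle type $1^{a_1}\cdots k^{a_k}1'^{b_1}\cdots k'^{b_k}$ means that in this decomposition, for each $i$, there are exactly $a_i$ cycles of length $i$ and exactly $b_i$ paths of length $i$. The falling factorial is $(m)_\ell=m(m-1)\cdots(m-\ell+1)$, with $(m)_0=1$. *)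

theory Defs
  imports Complex_Main "HOL-Library.FuncSet" "HOL-Library.Disjoint_Sets"
begin

definition k_perms :: "nat \<Rightarrow> nat \<Rightarrow> (nat \<Rightarrow> nat) set" where
  "k_perms k n = {p \<in> {1..k} \<rightarrow>\<^sub>E {1..n}. inj_on p {1..k}}"

definition is_chain :: "nat \<Rightarrow> (nat \<Rightarrow> nat) \<Rightarrow> nat list \<Rightarrow> bool" where
  "is_chain k p us \<longleftrightarrow>
     us \<noteq> [] \<and> distinct us \<and> set us \<subseteq> {1..k} \<and>
     (\<forall>t. Suc t < length us \<longrightarrow> p (us ! t) = us ! Suc t)"

definition is_cycle_seq :: "nat \<Rightarrow> (nat \<Rightarrow> nat) \<Rightarrow> nat list \<Rightarrow> bool" where
  "is_cycle_seq k p us \<longleftrightarrow> is_chain k p us \<and> p (last us) = hd us"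

(* Any suffix of a path is again a path in this sense; only the partition condition
   in is_decomposition singles out the maximal ones. *)
definition is_path :: "nat \<Rightarrow> (nat \<Rightarrow> nat) \<Rightarrow> nat list \<Rightarrow> bool" where
  "is_path k p us \<longleftrightarrow> is_chain k p us \<and> p (last us) \<notin> {1..k}"

definition rotation_class :: "'a list \<Rightarrow> 'a list set" where
  "rotation_class us = {rotate m us |m. True}"

(* A cycle is a sequence up to rotation, hence a set of lists. *)
definition cycles :: "nat \<Rightarrow> (nat \<Rightarrow> nat) \<Rightarrow> nat list set set" where
  "cycles k p = {rotation_class us |us. is_cycle_seq k p us}"

definition cycle_elems :: "'a list set \<Rightarrow> 'a set" where
  "cycle_elems c = (\<Union>us\<in>c. set us)"

(* All representatives of a rotation class have the same length. *)
definition cycle_has_length :: "'a list set \<Rightarrow> nat \<Rightarrow> bool" where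
  "cycle_has_length c l \<longleftrightarrow> (\<forall>us\<in>c. length us = l)"

definition is_decomposition ::
    "nat \<Rightarrow> (nat \<Rightarrow> nat) \<Rightarrow> nat list set set \<Rightarrow> nat list set \<Rightarrow> bool" where
  "is_decomposition k p C P \<longleftrightarrow>
     C \<subseteq> cycles k p \<and> P \<subseteq> {us. is_path k p us} \<and>
     disjoint_family_on cycle_elems C \<and> disjoint_family_on set P \<and>
     (\<Union>c\<in>C. cycle_elems c) \<inter> (\<Union>us\<in>P. set us) = {} \<and>
     (\<Union>c\<in>C. cycle_elems c) \<union> (\<Union>us\<in>P. set us) = {1..k}"

(* The decomposition of an injective map is unique, so "some" means "the" here. *)
definition has_cycle_type ::
    "nat \<Rightarrow> (nat \<Rightarrow> nat) \<Rightarrow> (nat \<Rightarrow> nat) \<Rightarrow> (nat \<Rightarrow> nat) \<Rightarrow> bool" where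
  "has_cycle_type k p a b \<longleftrightarrow>
     (\<exists>C P. is_decomposition k p C P \<and>
        (\<forall>i\<in>{1..k}. card {c \<in> C. cycle_has_length c i} = a i \<and>
                    card {us \<in> P. length us = i} = b i))"

definition falling_fact :: "'a::comm_ring_1 \<Rightarrow> nat \<Rightarrow> 'a" where
  "falling_fact m l = (\<Prod>j<l. m - of_nat j)"

end

theory Submission
  imports Defs "HOL-Library.Sublist"
begin

text \<open>
  A map is recorded by its set of cycles together with its set of pairs (path, value at the last
  element of the path); this correspondence is bijective. The families of cycles and paths with
  prescribed numbers of each length are counted by induction on the number of components. Counting
  pairs (family, chosen cycle of length \<open>i\<close>) in two ways and deleting the chosen cycle gives
  \<open>a\<^sub>i N(s, t; a, b) = (s)\<^sub>i / i \<sqdot> N(s - i, t; a - e\<^sub>i, b)\<close>, where \<open>s\<close> is the size of the domain and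
  \<open>t\<close> the number of available end values, and deleting a path gives
  \<open>b\<^sub>i N(s, t; a, b) = (s)\<^sub>i t \<sqdot> N(s - i, t - 1; a, b - e\<^sub>i)\<close>. The claimed formula satisfies both
  recursions.
\<close>

section \<open>Rotation classes\<close>

lemma self_in_rotation_class: "us \<in> rotation_class us"
  unfolding rotation_class_def by (rule CollectI, rule exI[of _ 0]) simp

lemma rotation_class_rotate: "rotation_class (rotate m us) = rotation_class us"
proof
  show "rotation_class (rotate m us) \<subseteq> rotation_class us"
    by (auto simp: rotation_class_def rotate_rotate)
  \<comment> \<open>The further rotation brings the total to \<open>length us * m\<close>, a whole
    number of turns, so a rotation by any \<open>m\<close> is undone without subtracting from
    \<open>m\<close>.\<close>
  have "us = rotate ((length us - 1) * m) (rotate m us)"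
  proof (cases "us = []")
    case False
    then have "(length us - 1) * m + m = length us * m"
      by (cases "length us") auto
    then show ?thesis by (simp add: rotate_rotate rotate_id)
  qed simp
  then obtain j where j: "us = rotate j (rotate m us)" by blast
  have "rotate r us = rotate (r + j) (rotate m us)" for r
    by (subst j) (simp only: rotate_rotate add.assoc)
  then show "rotation_class us \<subseteq> rotation_class (rotate m us)"
    unfolding rotation_class_def by blast
qed

lemma rotation_class_eq:
  assumes "ws \<in> rotation_class us"
  shows "rotation_class ws = rotation_class us"
proof -
  from assms obtain m where "ws = rotate m us" by (auto simp: rotation_class_def)
  then show ?thesis by (simp add: rotation_class_rotate)
qed

lemma cycle_elems_rotation_class [simp]: "cycle_elems (rotation_class us) = set us"
  by (auto simp: cycle_elems_def rotation_class_def)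

lemma cycle_has_length_rotation_class [simp]:
  "cycle_has_length (rotation_class us) l \<longleftrightarrow> length us = l"
proof -
  have "length ws = length us" if "ws \<in> rotation_class us" for ws
    using that by (auto simp: rotation_class_def)
  then show ?thesis
    using self_in_rotation_class unfolding cycle_has_length_def by metis
qed

text \<open>For \<open>m < length us\<close> the head of \<open>rotate m us\<close> is
  \<open>us ! m\<close>, so distinct entries give distinct rotations; larger amounts only repeat
  these modulo the length.\<close>

lemma card_rotation_class:
  assumes "distinct us" "us \<noteq> []"
  shows "card (rotation_class us) = length us"
proof -
  have "rotation_class us = (\<lambda>m. rotate m us) ` {..<length us}"
  proof -
    have "rotate m us \<in> (\<lambda>m. rotate m us) ` {..<length us}" for m
      using assms(2) by (subst rotate_conv_mod) auto
    then show ?thesis by (auto simp: rotation_class_def)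
  qed
  moreover have "inj_on (\<lambda>m. rotate m us) {..<length us}"
  proof (rule inj_onI)
    fix l m assume "l \<in> {..<length us}" "m \<in> {..<length us}" "rotate l us = rotate m us"
    moreover from this have "us ! l = us ! m"
      using hd_rotate_conv_nth[OF assms(2)] by (metis lessThan_iff mod_less)
    ultimately show "l = m"
      using assms(1) nth_eq_iff_index_eq by blast
  qed
  ultimately show ?thesis by (simp add: card_image)
qed

text \<open>Lets two overlapping cycles be started at a common element and compared entry by
  entry.\<close>

lemma rotation_class_hd:
  assumes "x \<in> set us"
  obtains zs where "x # zs \<in> rotation_class us"
proof -
  obtain as bs where "us = as @ x # bs" using assms by (meson split_list)
  then have "rotate (length as) us = x # bs @ as" by (simp add: rotate_append)
  then have "x # bs @ as \<in> rotation_class us"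
    unfolding rotation_class_def by (metis (mono_tags) mem_Collect_eq)
  then show thesis by (rule that)
qed

section \<open>Counting families of disjoint cycles and paths\<close>

text \<open>Candidate cycles with no map involved, encoded as in \<open>cycles\<close>.\<close>

definition cyclic_seqs :: "'a list set set" where
  "cyclic_seqs = {rotation_class us |us. us \<noteq> [] \<and> distinct us}"

text \<open>The list of a path does not determine the map at its last element, so that value is
  stored with it; \<open>T\<close> is the pool of end values.\<close>

definition ended_seqs :: "'b set \<Rightarrow> ('a list \<times> 'b) set" where
  "ended_seqs T = {(us, v). us \<noteq> [] \<and> distinct us \<and> v \<in> T}"

text \<open>\<open>S\<close> and \<open>T\<close> are arbitrary so that deleting a component can
  shrink them, while \<open>I\<close> stays fixed. The clause \<open>inj_on snd P\<close> encodes
  injectivity of the map at the ends of the paths.\<close>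

definition configs ::
    "nat set \<Rightarrow> 'a set \<Rightarrow> 'b set \<Rightarrow> (nat \<Rightarrow> nat) \<Rightarrow> (nat \<Rightarrow> nat) \<Rightarrow>
      ('a list set set \<times> ('a list \<times> 'b) set) set" where
  "configs I S T a b = {(C, P). C \<subseteq> cyclic_seqs \<and> P \<subseteq> ended_seqs T \<and>
     disjoint_family_on cycle_elems C \<and> disjoint_family_on (\<lambda>q. set (fst q)) P \<and> inj_on snd P \<and>
     (\<Union>c\<in>C. cycle_elems c) \<inter> (\<Union>q\<in>P. set (fst q)) = {} \<and>
     (\<Union>c\<in>C. cycle_elems c) \<union> (\<Union>q\<in>P. set (fst q)) = S \<and>
     (\<forall>i\<in>I. card {c \<in> C. cycle_has_length c i} = a i \<and> card {q \<in> P. length (fst q) = i} = b i)}"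

lemma cycle_elems_nonempty: "c \<in> cyclic_seqs \<Longrightarrow> cycle_elems c \<noteq> {}"
  by (auto simp: cyclic_seqs_def)

lemma cyclic_seqs_length_unique:
  "c \<in> cyclic_seqs \<Longrightarrow> cycle_has_length c i \<Longrightarrow> cycle_has_length c j \<longleftrightarrow> i = j"
  by (auto simp: cyclic_seqs_def)

lemma card_cycle_elems: "c \<in> cyclic_seqs \<Longrightarrow> cycle_has_length c i \<Longrightarrow> card (cycle_elems c) = i"
  by (auto simp: cyclic_seqs_def distinct_card)

lemma finite_distinct_seqs: "finite S \<Longrightarrow> finite {us. distinct us \<and> set us \<subseteq> S}"
  by (rule finite_subset[OF _ finite_subset_distinct[of S]]) auto

lemma finite_cyclic_seqs:
  assumes "finite S" shows "finite {c \<in> cyclic_seqs. cycle_elems c \<subseteq> S}"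
proof (rule finite_subset)
  show "{c \<in> cyclic_seqs. cycle_elems c \<subseteq> S} \<subseteq> rotation_class ` {us. distinct us \<and> set us \<subseteq> S}"
    by (auto simp: cyclic_seqs_def)
qed (simp add: finite_distinct_seqs assms)

lemma finite_ended_seqs:
  assumes "finite S" "finite T" shows "finite {q \<in> ended_seqs T. set (fst q) \<subseteq> S}"
proof (rule finite_subset)
  show "{q \<in> ended_seqs T. set (fst q) \<subseteq> S} \<subseteq> {us. distinct us \<and> set us \<subseteq> S} \<times> T"
    by (auto simp: ended_seqs_def)
qed (simp add: finite_distinct_seqs assms)

text \<open>The ambient set gives finiteness and excludes components that do not fit into
  \<open>S\<close>.\<close>

lemma configs_subset:
  "configs I S T a b \<subseteq>
     Pow {c \<in> cyclic_seqs. cycle_elems c \<subseteq> S} \<times> Pow {q \<in> ended_seqs T. set (fst q) \<subseteq> S}"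
  unfolding configs_def by fast

lemma finite_configs: "finite S \<Longrightarrow> finite T \<Longrightarrow> finite (configs I S T a b)"
  by (rule finite_subset[OF configs_subset]) (simp add: finite_cyclic_seqs finite_ended_seqs)

section \<open>Counting single components\<close>

text \<open>The falling factorial is a quotient of factorials here so that
  \<open>fact (card S - i)\<close> cancels against the induction hypothesis in
  \<open>card_configs\<close>.\<close>

lemma card_distinct_seqs:
  assumes "finite S" "i \<le> card S"
  shows "real (card {us. length us = i \<and> distinct us \<and> set us \<subseteq> S}) =
    fact (card S) / fact (card S - i)"
proof -
  have "fact (card S) = (fact (card S - i) :: nat) * \<Prod>{card S - i + 1..card S}"
    using fact_div_fact[of "card S - i" "card S"] fact_dvd[of "card S - i" "card S"]
    by (metis diff_le_self dvd_mult_div_cancel)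
  then have "(fact (card S) :: real) = fact (card S - i) * real (\<Prod>{card S - i + 1..card S})"
    by (metis of_nat_fact of_nat_mult)
  then show ?thesis using card_lists_distinct_length_eq[OF assms(1,2)] by simp
qed

text \<open>The rotation classes of length \<open>i\<close> partition the repetition-free lists of
  length \<open>i\<close> over \<open>S\<close> into blocks of size \<open>i\<close>.\<close>

lemma card_cyclic_seqs:
  assumes "finite S" "i \<le> card S" "0 < i"
  shows "real i * real (card {c \<in> cyclic_seqs. cycle_has_length c i \<and> cycle_elems c \<subseteq> S}) =
    fact (card S) / fact (card S - i)"
proof -
  let ?C = "{c \<in> cyclic_seqs. cycle_has_length c i \<and> cycle_elems c \<subseteq> S}"
  let ?L = "{us. length us = i \<and> distinct us \<and> set us \<subseteq> S}"
  have un: "\<Union>?C = ?L"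
  proof
    show "\<Union>?C \<subseteq> ?L"
    proof (rule, elim UnionE)
      fix us c assume "us \<in> c" "c \<in> ?C"
      then obtain ws where "us \<in> rotation_class ws" "distinct ws" "length ws = i" "set ws \<subseteq> S"
        by (auto simp: cyclic_seqs_def)
      then show "us \<in> ?L" by (auto simp: rotation_class_def)
    qed
    have "rotation_class us \<in> ?C" if "us \<in> ?L" for us
      using that assms(3) by (auto simp: cyclic_seqs_def)
    then show "?L \<subseteq> \<Union>?C" using self_in_rotation_class by blast
  qed
  have "i * card ?C = card (\<Union>?C)"
  proof (rule card_partition)
    show "finite ?C"
      by (rule finite_subset[OF _ finite_cyclic_seqs[OF assms(1)]]) auto
    show "finite (\<Union>?C)"
      unfolding un by (rule finite_subset[OF _ finite_distinct_seqs[OF assms(1)]]) auto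
    show "\<And>c. c \<in> ?C \<Longrightarrow> card c = i" by (auto simp: cyclic_seqs_def card_rotation_class)
    show "c \<inter> d = {}" if "c \<in> ?C" "d \<in> ?C" "c \<noteq> d" for c d
    proof (rule ccontr)
      assume "c \<inter> d \<noteq> {}"
      then obtain us where "us \<in> c" "us \<in> d" by blast
      moreover obtain vs ws where "c = rotation_class vs" "d = rotation_class ws"
        using \<open>c \<in> ?C\<close> \<open>d \<in> ?C\<close> by (auto simp: cyclic_seqs_def)
      ultimately show False using rotation_class_eq \<open>c \<noteq> d\<close> by metis
    qed
  qed
  then show ?thesis
    using un card_distinct_seqs[OF assms(1,2)] by (metis of_nat_mult)
qed

lemma card_ended_seqs:
  assumes "finite S" "i \<le> card S" "0 < i"
  shows "real (card {q \<in> ended_seqs T. length (fst q) = i \<and> set (fst q) \<subseteq> S}) =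
    fact (card S) / fact (card S - i) * real (card T)"
proof -
  have "{q \<in> ended_seqs T. length (fst q) = i \<and> set (fst q) \<subseteq> S} =
     {us. length us = i \<and> distinct us \<and> set us \<subseteq> S} \<times> T"
    using assms(3) by (auto simp: ended_seqs_def)
  then show ?thesis
    using card_distinct_seqs[OF assms(1,2)] by (simp add: card_cartesian_product)
qed

section \<open>Deleting one component from a configuration\<close>

text \<open>Disjointness of \<open>c\<close> from the other components becomes the demand that they
  cover exactly \<open>S - cycle_elems c\<close>. By \<open>0 < a i\<close> the truncated
  \<open>a i - 1\<close> is a true predecessor.\<close>

lemma configs_insert_cycle:
  assumes fin: "finite S" and c: "c \<in> cyclic_seqs" "cycle_has_length c i" "cycle_elems c \<subseteq> S"
    and "c \<notin> C" "0 < a i"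
  shows "(insert c C, P) \<in> configs I S T a b \<longleftrightarrow>
    (C, P) \<in> configs I (S - cycle_elems c) T (a(i := a i - 1)) b"
\<comment> \<open>The case assumption makes the counted sets finite, so inserting \<open>c\<close>
  raises the cardinality by one; if it fails, both sides are false.\<close>
proof (cases "C \<subseteq> {c \<in> cyclic_seqs. cycle_elems c \<subseteq> S}")
  case True
  have "finite {c \<in> C. cycle_has_length c j}" for j
    by (rule finite_subset[OF _ finite_cyclic_seqs[OF fin]]) (use True in auto)
  moreover have "{d \<in> insert c C. cycle_has_length d j} =
      (if j = i then insert c {d \<in> C. cycle_has_length d j} else {d \<in> C. cycle_has_length d j})" for j
    using cyclic_seqs_length_unique[OF c(1,2)] c(2) by auto
  ultimately have "card {d \<in> insert c C. cycle_has_length d j} = a j \<longleftrightarrow>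
      card {d \<in> C. cycle_has_length d j} = (a(i := a i - 1)) j" for j
    using \<open>c \<notin> C\<close> \<open>0 < a i\<close> by auto
  moreover have "disjoint_family_on cycle_elems (insert c C) \<longleftrightarrow>
      cycle_elems c \<inter> (\<Union>d\<in>C. cycle_elems d) = {} \<and> disjoint_family_on cycle_elems C"
    using \<open>c \<notin> C\<close> by (rule disjoint_family_on_insert)
  ultimately show ?thesis
    using c(1,3) unfolding configs_def by auto
next
  case False
  then show ?thesis using configs_subset by blast
qed

lemma configs_insert_path:
  assumes fin: "finite S" "finite T" and q: "q \<in> ended_seqs T" "length (fst q) = i" "set (fst q) \<subseteq> S"
    and "q \<notin> P" "0 < b i"
  shows "(C, insert q P) \<in> configs I S T a b \<longleftrightarrow>
    (C, P) \<in> configs I (S - set (fst q)) (T - {snd q}) a (b(i := b i - 1))"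
proof (cases "P \<subseteq> {q \<in> ended_seqs T. set (fst q) \<subseteq> S}")
  case True
  have "finite {q \<in> P. length (fst q) = j}" for j
    by (rule finite_subset[OF _ finite_ended_seqs[OF fin]]) (use True in auto)
  moreover have "{r \<in> insert q P. length (fst r) = j} =
      (if j = i then insert q {r \<in> P. length (fst r) = j} else {r \<in> P. length (fst r) = j})" for j
    using q(2) by auto
  ultimately have "card {r \<in> insert q P. length (fst r) = j} = b j \<longleftrightarrow>
      card {r \<in> P. length (fst r) = j} = (b(i := b i - 1)) j" for j
    using \<open>q \<notin> P\<close> \<open>0 < b i\<close> by auto
  then have cards: "(\<forall>j\<in>I. card {c \<in> C. cycle_has_length c j} = a j \<and>
        card {r \<in> insert q P. length (fst r) = j} = b j) \<longleftrightarrow>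
      (\<forall>j\<in>I. card {c \<in> C. cycle_has_length c j} = a j \<and>
        card {r \<in> P. length (fst r) = j} = (b(i := b i - 1)) j)"
    by simp
  have disj: "disjoint_family_on (\<lambda>q. set (fst q)) (insert q P) \<longleftrightarrow>
      set (fst q) \<inter> (\<Union>r\<in>P. set (fst r)) = {} \<and> disjoint_family_on (\<lambda>q. set (fst q)) P"
    using \<open>q \<notin> P\<close> by (rule disjoint_family_on_insert)
  \<comment> \<open>Injectivity of \<open>snd\<close> on the enlarged family says that no other path
    ends at \<open>snd q\<close>, that is, the others draw their end values from
    \<open>T - {snd q}\<close>.\<close>
  have ends: "insert q P \<subseteq> ended_seqs T \<and> inj_on snd (insert q P) \<longleftrightarrow>
      P \<subseteq> ended_seqs (T - {snd q}) \<and> inj_on snd P"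
    using q(1) \<open>q \<notin> P\<close> by (force simp: ended_seqs_def)
  \<comment> \<open>Set algebra with \<open>E\<close> the new path, \<open>B\<close> the other paths
    and \<open>A\<close> the cycles. The next fact supplies \<open>E \<inter> B = {}\<close> when
    the equivalence is read from right to left.\<close>
  have cover: "A \<inter> (E \<union> B) = {} \<and> A \<union> (E \<union> B) = S \<longleftrightarrow> A \<inter> B = {} \<and> A \<union> B = S - E"
    if "E \<inter> B = {}" "E \<subseteq> S" for A B E :: "'a set"
    using that by blast
  have "E \<inter> B = {}" if "A \<union> B = S - E" for A B E :: "'a set"
    using that by blast
  note cover' = this[of "\<Union>c\<in>C. cycle_elems c" "\<Union>r\<in>P. set (fst r)" "set (fst q)"]
    cover[of "set (fst q)" "\<Union>r\<in>P. set (fst r)" "\<Union>c\<in>C. cycle_elems c", OF _ q(3)]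
  show ?thesis
    unfolding configs_def mem_Collect_eq prod.case UN_insert
    using cards disj ends cover' by argo
next
  case False
  have "ended_seqs (T - {snd q}) \<subseteq> ended_seqs T" by (auto simp: ended_seqs_def)
  then show ?thesis using False configs_subset by blast
qed

text \<open>Deleting \<open>c\<close> and inserting it again are mutually inverse.\<close>

lemma card_configs_cycle:
  assumes fin: "finite S" and c: "c \<in> cyclic_seqs" "cycle_has_length c i" "cycle_elems c \<subseteq> S"
    and "0 < a i"
  shows "card {x \<in> configs I S T a b. c \<in> fst x} =
    card (configs I (S - cycle_elems c) T (a(i := a i - 1)) b)"
proof (rule bij_betw_same_card,
    rule bij_betw_byWitness[where f="\<lambda>(C, P). (C - {c}, P)" and f'="\<lambda>(C, P). (insert c C, P)"])
  let ?f = "\<lambda>(C, P). (C - {c}, P)" and ?g = "\<lambda>(C, P). (insert c C, P)"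
  let ?A = "{x \<in> configs I S T a b. c \<in> fst x}"
  let ?B = "configs I (S - cycle_elems c) T (a(i := a i - 1)) b"
  \<comment> \<open>Since \<open>c\<close> is nonempty, it does not fit into
    \<open>S - cycle_elems c\<close>; hence deletion undoes insertion.\<close>
  have new: "c \<notin> fst x" if "x \<in> ?B" for x
    using that configs_subset[of I "S - cycle_elems c" T] cycle_elems_nonempty[OF c(1)] by fastforce
  show "\<forall>x\<in>?A. ?g (?f x) = x" by auto
  show "\<forall>x\<in>?B. ?f (?g x) = x" using new by fastforce
  note ins = configs_insert_cycle[where a=a and i=i and I=I and T=T and b=b, OF fin c _ \<open>0 < a i\<close>]
  show "?f ` ?A \<subseteq> ?B"
  proof
    fix y assume "y \<in> ?f ` ?A"
    then obtain C P where "(C, P) \<in> configs I S T a b" "c \<in> C" "y = (C - {c}, P)" by auto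
    then show "y \<in> ?B" using ins[of "C - {c}" P] by (simp add: insert_absorb)
  qed
  show "?g ` ?B \<subseteq> ?A"
  proof
    fix y assume "y \<in> ?g ` ?B"
    then obtain C P where CP: "(C, P) \<in> ?B" "y = (insert c C, P)" by auto
    then have "c \<notin> C" using new by fastforce
    then show "y \<in> ?A" using ins CP by simp
  qed
qed

lemma card_configs_path:
  assumes fin: "finite S" "finite T" and q: "q \<in> ended_seqs T" "length (fst q) = i" "set (fst q) \<subseteq> S"
    and "0 < b i"
  shows "card {x \<in> configs I S T a b. q \<in> snd x} =
    card (configs I (S - set (fst q)) (T - {snd q}) a (b(i := b i - 1)))"
proof (rule bij_betw_same_card,
    rule bij_betw_byWitness[where f="\<lambda>(C, P). (C, P - {q})" and f'="\<lambda>(C, P). (C, insert q P)"])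
  let ?f = "\<lambda>(C, P). (C, P - {q})" and ?g = "\<lambda>(C, P). (C, insert q P)"
  let ?A = "{x \<in> configs I S T a b. q \<in> snd x}"
  let ?B = "configs I (S - set (fst q)) (T - {snd q}) a (b(i := b i - 1))"
  \<comment> \<open>The end value of \<open>q\<close> has left the pool.\<close>
  have new: "q \<notin> snd x" if "x \<in> ?B" for x
    using that configs_subset[of I "S - set (fst q)" "T - {snd q}"]
    by (fastforce simp: ended_seqs_def)
  show "\<forall>x\<in>?A. ?g (?f x) = x" by auto
  show "\<forall>x\<in>?B. ?f (?g x) = x" using new by fastforce
  note ins = configs_insert_path[where a=a and i=i and I=I and b=b, OF fin q _ \<open>0 < b i\<close>]
  show "?f ` ?A \<subseteq> ?B"
  proof
    fix y assume "y \<in> ?f ` ?A"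
    then obtain C P where "(C, P) \<in> configs I S T a b" "q \<in> P" "y = (C, P - {q})" by auto
    then show "y \<in> ?B" using ins[of "P - {q}" C] by (simp add: insert_absorb)
  qed
  show "?g ` ?B \<subseteq> ?A"
  proof
    fix y assume "y \<in> ?g ` ?B"
    then obtain C P where CP: "(C, P) \<in> ?B" "y = (C, insert q P)" by auto
    then have "q \<notin> P" using new by fastforce
    then show "y \<in> ?A" using ins CP by simp
  qed
qed

section \<open>Double counting of pairs (configuration, chosen component)\<close>

text \<open>Incidences are summed once over the cycles and once over the configurations, each of
  which contains exactly \<open>a i\<close> cycles of length \<open>i\<close>.\<close>

lemma configs_double_count_cycles:
  assumes "finite S" "finite T" "i \<in> I"
  shows "(\<Sum>c\<in>{c \<in> cyclic_seqs. cycle_has_length c i \<and> cycle_elems c \<subseteq> S}.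
      card {x \<in> configs I S T a b. c \<in> fst x}) = a i * card (configs I S T a b)"
proof -
  have "card {c \<in> {c \<in> cyclic_seqs. cycle_has_length c i \<and> cycle_elems c \<subseteq> S}. c \<in> fst x} = a i"
    if x: "x \<in> configs I S T a b" for x
  proof -
    have "{c \<in> {c \<in> cyclic_seqs. cycle_has_length c i \<and> cycle_elems c \<subseteq> S}. c \<in> fst x} =
        {c \<in> fst x. cycle_has_length c i}"
      using subsetD[OF configs_subset x] by (auto simp: mem_Times_iff)
    then show ?thesis using x assms(3) by (auto simp: configs_def)
  qed
  then show ?thesis
    using sum_multicount_gen[of "{c \<in> cyclic_seqs. cycle_has_length c i \<and> cycle_elems c \<subseteq> S}"
        "configs I S T a b" "\<lambda>c x. c \<in> fst x" "\<lambda>_. a i"]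
      finite_configs[OF assms(1,2)]
      finite_subset[OF _ finite_cyclic_seqs[OF assms(1)],
        of "{c \<in> cyclic_seqs. cycle_has_length c i \<and> cycle_elems c \<subseteq> S}"]
    by (auto simp: mult.commute)
qed

lemma configs_double_count_paths:
  assumes "finite S" "finite T" "i \<in> I"
  shows "(\<Sum>q\<in>{q \<in> ended_seqs T. length (fst q) = i \<and> set (fst q) \<subseteq> S}.
      card {x \<in> configs I S T a b. q \<in> snd x}) = b i * card (configs I S T a b)"
proof -
  have "card {q \<in> {q \<in> ended_seqs T. length (fst q) = i \<and> set (fst q) \<subseteq> S}. q \<in> snd x} = b i"
    if x: "x \<in> configs I S T a b" for x
  proof -
    have "{q \<in> {q \<in> ended_seqs T. length (fst q) = i \<and> set (fst q) \<subseteq> S}. q \<in> snd x} =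
        {q \<in> snd x. length (fst q) = i}"
      using subsetD[OF configs_subset x] by (auto simp: mem_Times_iff)
    then show ?thesis using x assms(3) by (auto simp: configs_def)
  qed
  then show ?thesis
    using sum_multicount_gen[of "{q \<in> ended_seqs T. length (fst q) = i \<and> set (fst q) \<subseteq> S}"
        "configs I S T a b" "\<lambda>q x. q \<in> snd x" "\<lambda>_. b i"]
      finite_configs[OF assms(1,2)]
      finite_subset[OF _ finite_ended_seqs[OF assms(1,2)],
        of "{q \<in> ended_seqs T. length (fst q) = i \<and> set (fst q) \<subseteq> S}"]
    by (auto simp: mult.commute)
qed

section \<open>From the recursions to the closed formula\<close>

text \<open>The first factor is split off rather than the last, matching the removal of one end
  value from \<open>T\<close>.\<close>

lemma falling_fact_Suc: "falling_fact m (Suc l) = m * falling_fact (m - 1) l"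
  unfolding falling_fact_def by (subst prod.lessThan_Suc_shift) (simp add: algebra_simps)

text \<open>Applied with \<open>f j = j\<close> for the size of the domain and with
  \<open>f j = 1\<close> for the number of components.\<close>

lemma sum_decr:
  fixes f a :: "nat \<Rightarrow> nat"
  assumes "finite I" "i \<in> I" "0 < a i"
  shows "(\<Sum>j\<in>I. f j * a j) = f i + (\<Sum>j\<in>I. f j * (a(i := a i - 1)) j)"
proof -
  have "(\<Sum>j\<in>I - {i}. f j * a j) = (\<Sum>j\<in>I - {i}. f j * (a(i := a i - 1)) j)"
    by (rule sum.cong) auto
  moreover have "f i * a i = f i + f i * (a i - 1)"
    using assms(3) by (cases "a i") auto
  ultimately show ?thesis
    using assms(1,2) by (simp add: sum.remove[of I i])
qed

text \<open>Tracks the denominator of the formula: the ratio \<open>r\<close> is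
  \<open>i * a i\<close> when a cycle is deleted and \<open>b i\<close> when a path is
  deleted.\<close>

lemma prod_decr:
  fixes h :: "nat \<Rightarrow> nat \<Rightarrow> real"
  assumes "finite I" "i \<in> I" "h i (a i) = r * h i (a i - 1)"
  shows "(\<Prod>j\<in>I. h j (a j)) = r * (\<Prod>j\<in>I. h j ((a(i := a i - 1)) j))"
proof -
  have "(\<Prod>j\<in>I - {i}. h j (a j)) = (\<Prod>j\<in>I - {i}. h j ((a(i := a i - 1)) j))"
    by (rule prod.cong) auto
  then show ?thesis
    using assms by (simp add: prod.remove[of I i])
qed

text \<open>The pool \<open>T\<close> may be too small: with more paths than end values both sides
  vanish. The condition \<open>0 \<notin> I\<close> keeps the denominator nonzero.\<close>

lemma card_configs:
  fixes S :: "'a set" and T :: "'b set"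
  assumes "finite I" "0 \<notin> I" "finite S" "finite T" "(\<Sum>i\<in>I. i * (a i + b i)) = card S"
  shows "real (card (configs I S T a b)) =
    fact (card S) / (\<Prod>i\<in>I. real i ^ a i * fact (a i) * fact (b i)) *
    falling_fact (real (card T)) (\<Sum>i\<in>I. b i)"
  using assms(3-)
proof (induction "\<Sum>i\<in>I. a i + b i" arbitrary: S T a b)
  case 0
  then have z: "a i = 0" "b i = 0" if "i \<in> I" for i
    using that assms(1) by auto
  then have "S = {}" using 0 by simp
  \<comment> \<open>Components are nonempty, so none fits into the empty domain and only the empty
    configuration remains.\<close>
  have "{c \<in> cyclic_seqs. cycle_elems c \<subseteq> {}} = ({} :: 'a list set set)"
    and "{q \<in> ended_seqs T. set (fst q) \<subseteq> {}} = ({} :: ('a list \<times> 'b) set)"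
    using cycle_elems_nonempty by (auto simp: ended_seqs_def)
  then have "configs I S T a b \<subseteq> Pow {} \<times> Pow {}"
    using configs_subset[of I S T a b] by (simp only: \<open>S = {}\<close>)
  moreover have "({}, {}) \<in> configs I S T a b"
    using z \<open>S = {}\<close> by (simp add: configs_def disjoint_family_on_def)
  ultimately have "configs I S T a b = {({}, {})}" by auto
  then show ?case using z \<open>S = {}\<close> by (simp add: falling_fact_def)
next
  case (Suc m)
  let ?den = "\<lambda>a b. \<Prod>i\<in>I. real i ^ a i * fact (a i) * fact (b i)"
  \<comment> \<open>The factors \<open>1\<close> put the second equation into the shape of
    \<open>sum_decr\<close> with constant weight.\<close>
  have sums: "(\<Sum>i\<in>I. i * a i) + (\<Sum>i\<in>I. i * b i) = card S"
      "Suc m = (\<Sum>i\<in>I. 1 * a i) + (\<Sum>i\<in>I. 1 * b i)"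
    using Suc by (simp_all add: sum.distrib algebra_simps)
  have den_pos: "?den a b > 0" for a b :: "nat \<Rightarrow> nat"
  proof (rule prod_pos)
    fix i assume "i \<in> I"
    then have "0 < i" using assms(2) by (metis neq0_conv)
    then show "0 < real i ^ a i * fact (a i) * fact (b i)" by simp
  qed
  have "(\<Sum>i\<in>I. a i + b i) \<noteq> 0" using Suc(2) by simp
  then obtain i where "i \<in> I" "a i + b i \<noteq> 0"
    by (rule sum.not_neutral_contains_not_neutral)
  then have i: "i \<in> I" "0 < a i \<or> 0 < b i" by auto
  have "0 < i" using assms(2) i(1) by (cases i) auto
  from i(2) show ?case
  proof
    assume ai: "0 < a i"
    define a' where "a' = a(i := a i - 1)"
    let ?X = "{c \<in> cyclic_seqs. cycle_has_length c i \<and> cycle_elems c \<subseteq> S}"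
    \<comment> \<open>Exhibiting \<open>card S\<close> as \<open>i\<close> plus a remainder shows
      that \<open>card S - i\<close> is not truncated.\<close>
    have s1: "card S = i + ((\<Sum>i\<in>I. i * a' i) + (\<Sum>i\<in>I. i * b i))"
      and s2: "m = (\<Sum>i\<in>I. a' i) + (\<Sum>i\<in>I. b i)"
      using sums sum_decr[OF assms(1) i(1), of a "\<lambda>j. j"]
        sum_decr[OF assms(1) i(1), of a "\<lambda>_. 1"] ai by (simp_all add: a'_def)
    have IH: "real (card (configs I (S - cycle_elems c) T a' b)) =
      fact (card S - i) / ?den a' b * falling_fact (real (card T)) (\<Sum>i\<in>I. b i)" if "c \<in> ?X" for c
    proof -
      have "card (S - cycle_elems c) = card S - i"
        using that card_cycle_elems Suc.prems(1)
        by (metis (mono_tags, lifting) card_Diff_subset finite_subset mem_Collect_eq)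
      then show ?thesis
        using Suc(1)[of a' b "S - cycle_elems c" T] s1 s2 Suc.prems
        by (simp add: sum.distrib algebra_simps)
    qed
    have "real (a i) * card (configs I S T a b) =
        (\<Sum>c\<in>?X. real (card {x \<in> configs I S T a b. c \<in> fst x}))"
      using arg_cong[where f=real, OF configs_double_count_cycles[OF Suc.prems(1,2) i(1), of a b]]
      by simp
    also have "\<dots> = (\<Sum>c\<in>?X. fact (card S - i) / ?den a' b * falling_fact (real (card T)) (\<Sum>i\<in>I. b i))"
      using IH card_configs_cycle[where a=a and i=i, OF Suc.prems(1) _ _ _ ai, of _ I T b]
      by (intro sum.cong) (auto simp: a'_def)
    \<comment> \<open>The extra factor \<open>real i\<close> matches the form of
      \<open>card_cyclic_seqs\<close>.\<close>
    finally have "real i * (a i * card (configs I S T a b)) =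
        (real i * real (card ?X)) * (fact (card S - i) / ?den a' b * falling_fact (real (card T)) (\<Sum>i\<in>I. b i))"
      by simp
    also have "real i * real (card ?X) = fact (card S) / fact (card S - i)"
      by (rule card_cyclic_seqs) (use Suc.prems(1) s1 \<open>0 < i\<close> in auto)
    finally have "real i * (a i * card (configs I S T a b)) =
        fact (card S) / ?den a' b * falling_fact (real (card T)) (\<Sum>i\<in>I. b i)"
      by simp
    moreover have "?den a b = (real i * a i) * ?den a' b"
      unfolding a'_def
      by (rule prod_decr[where h="\<lambda>j r. real j ^ r * fact r * fact (b j)", OF assms(1) i(1)])
        (use ai in \<open>cases "a i"; simp\<close>)
    ultimately show ?thesis
      using den_pos[of a' b] \<open>0 < i\<close> ai by (simp add: field_simps)
  next
    assume bi: "0 < b i"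
    define b' where "b' = b(i := b i - 1)"
    let ?X = "{q \<in> ended_seqs T. length (fst q) = i \<and> set (fst q) \<subseteq> S} :: ('a list \<times> 'b) set"
    have s1: "card S = i + ((\<Sum>i\<in>I. i * a i) + (\<Sum>i\<in>I. i * b' i))"
      and s2: "m = (\<Sum>i\<in>I. a i) + (\<Sum>i\<in>I. b' i)" and s3: "(\<Sum>i\<in>I. b i) = Suc (\<Sum>i\<in>I. b' i)"
      using sums sum_decr[OF assms(1) i(1), of b "\<lambda>j. j"]
        sum_decr[OF assms(1) i(1), of b "\<lambda>_. 1"] bi by (simp_all add: b'_def)
    \<comment> \<open>The path also uses up its end value, so the falling factorial starts at
      \<open>card T - 1\<close>; \<open>falling_fact_Suc\<close> later absorbs the factor
      \<open>card T\<close> from the choice of that value.\<close>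
    have IH: "real (card (configs I (S - set (fst q)) (T - {snd q}) a b')) =
      fact (card S - i) / ?den a b' * falling_fact (real (card T) - 1) (\<Sum>i\<in>I. b' i)" if "q \<in> ?X" for q
    proof -
      have cS: "card (S - set (fst q)) = card S - i"
        using that by (auto simp: card_Diff_subset ended_seqs_def distinct_card)
      have T: "snd q \<in> T" using that by (auto simp: ended_seqs_def)
      then have "0 < card T" using Suc.prems(2) card_gt_0_iff by blast
      then have cT: "real (card (T - {snd q})) = real (card T) - 1"
        using T by (simp add: card_Diff_singleton of_nat_diff)
      have "m = (\<Sum>i\<in>I. a i + b' i)" "(\<Sum>i\<in>I. i * (a i + b' i)) = card (S - set (fst q))"
        using s1 s2 cS by (simp_all add: sum.distrib algebra_simps)
      then show ?thesis
        using Suc(1)[of a b' "S - set (fst q)" "T - {snd q}"] Suc.prems(1,2)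
        unfolding cS cT by simp
    qed
    have "real (b i) * card (configs I S T a b) =
        (\<Sum>q\<in>?X. real (card {x \<in> configs I S T a b. q \<in> snd x}))"
      using arg_cong[where f=real, OF configs_double_count_paths[OF Suc.prems(1,2) i(1), of a b]]
      by simp
    also have "\<dots> = (\<Sum>q\<in>?X. fact (card S - i) / ?den a b' * falling_fact (real (card T) - 1) (\<Sum>i\<in>I. b' i))"
      using IH card_configs_path[where b=b and i=i, OF Suc.prems(1,2) _ _ _ bi, of _ I a]
      by (intro sum.cong) (auto simp: b'_def)
    finally have "real (b i) * card (configs I S T a b) =
        real (card ?X) * (fact (card S - i) / ?den a b' * falling_fact (real (card T) - 1) (\<Sum>i\<in>I. b' i))"
      by simp
    also have "real (card ?X) = fact (card S) / fact (card S - i) * real (card T)"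
      by (rule card_ended_seqs) (use Suc.prems(1) s1 \<open>0 < i\<close> in auto)
    finally have "real (b i) * card (configs I S T a b) =
        fact (card S) / ?den a b' * falling_fact (real (card T)) (\<Sum>i\<in>I. b i)"
      by (simp add: s3 falling_fact_Suc)
    moreover have "?den a b = real (b i) * ?den a b'"
      unfolding b'_def
      by (rule prod_decr[where h="\<lambda>j r. real j ^ a j * fact (a j) * fact r", OF assms(1) i(1)])
        (use bi in \<open>cases "b i"; simp\<close>)
    ultimately show ?thesis
      using den_pos[of a b'] bi by (simp add: field_simps)
  qed
qed

section \<open>Cycles and paths of an injective map\<close>

text \<open>
  Written with \<^const>\<open>map\<close>, a cycle satisfies \<open>map p us = rotate1 us\<close>, which is manifestly invariant
  under rotation, and a path satisfies \<open>map p us = tl us @ [v]\<close> with \<open>v\<close> outside the domain.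
\<close>

lemma is_chain_iff_map:
  "is_chain k p us \<longleftrightarrow>
    us \<noteq> [] \<and> distinct us \<and> set us \<subseteq> {1..k} \<and> map p us = tl us @ [p (last us)]"
proof (cases us rule: rev_cases)
  case (snoc ws x)
  have "(\<forall>t. Suc t < length us \<longrightarrow> p (us ! t) = us ! Suc t) \<longleftrightarrow> map p ws = tl (ws @ [x])"
    unfolding snoc list_eq_iff_nth_eq by (auto simp: nth_append nth_tl)
  moreover have "map p us = tl us @ [p (last us)] \<longleftrightarrow> map p ws = tl (ws @ [x])"
    unfolding snoc by simp
  ultimately show ?thesis by (simp add: is_chain_def)
qed (simp add: is_chain_def)

lemma is_path_iff_map:
  "is_path k p us \<longleftrightarrow> us \<noteq> [] \<and> distinct us \<and> set us \<subseteq> {1..k} \<and>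
    (\<exists>v. v \<notin> {1..k} \<and> map p us = tl us @ [v])"
proof -
  have "map p us = tl us @ [v] \<Longrightarrow> us \<noteq> [] \<Longrightarrow> v = p (last us)" for v
    by (metis last_map last_snoc)
  then show ?thesis unfolding is_path_def is_chain_iff_map by blast
qed

lemma is_cycle_seq_iff_map:
  "is_cycle_seq k p us \<longleftrightarrow>
    us \<noteq> [] \<and> distinct us \<and> set us \<subseteq> {1..k} \<and> map p us = rotate1 us"
proof -
  have "map p us = rotate1 us \<longleftrightarrow> map p us = tl us @ [p (last us)] \<and> p (last us) = hd us"
    if "us \<noteq> []"
    using that by (metis last_map last_snoc rotate1_hd_tl)
  then show ?thesis unfolding is_cycle_seq_def is_chain_iff_map by blast
qed

lemma is_cycle_seq_rotation_class:
  "is_cycle_seq k p us \<Longrightarrow> ws \<in> rotation_class us \<Longrightarrow> is_cycle_seq k p ws"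
  by (auto simp: is_cycle_seq_iff_map rotation_class_def rotate_map[symmetric] rotate1_rotate_swap)

lemma cycles_subset_cyclic_seqs: "cycles k p \<subseteq> cyclic_seqs"
  by (auto simp: cycles_def cyclic_seqs_def is_cycle_seq_iff_map)

lemma cycles_is_cycle_seq: "c \<in> cycles k p \<Longrightarrow> us \<in> c \<Longrightarrow> is_cycle_seq k p us"
  using is_cycle_seq_rotation_class by (auto simp: cycles_def)

text \<open>
  Used with \<open>X\<close> the complement of the domain for paths, and with \<open>X = {u}\<close> for cycles.
\<close>

lemma walk_unique:
  assumes "map p (u # xs) = xs @ [v]" "map p (u # ys) = ys @ [w]"
    and "v \<in> X" "w \<in> X" "set xs \<inter> X = {}" "set ys \<inter> X = {}"
  shows "xs = ys"
  using assms
proof (induction xs arbitrary: u ys)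
  case Nil
  then show ?case by (cases ys) auto
next
  case (Cons x xs)
  then show ?case by (cases ys) auto
qed

text \<open>Serves to show that a path meeting a cycle could never leave it.\<close>

lemma walk_in_closed:
  assumes "map p (u # xs) = xs @ [v]" "u \<in> U" "p ` U \<subseteq> U"
  shows "v \<in> U"
  using assms by (induction xs arbitrary: u) auto

text \<open>In \<open>map p us = tl us @ [v]\<close> both sides lose the same number of leading
  entries; the right side, shifted by one, then starts just after \<open>x\<close>.\<close>

lemma path_suffix_walk:
  assumes "is_path k p us" "x \<in> set us"
  obtains xs v where "suffix (x # xs) us" "map p (x # xs) = xs @ [v]" "v \<notin> {1..k}" "set xs \<subseteq> {1..k}"
proof -
  obtain v where v: "v \<notin> {1..k}" "map p us = tl us @ [v]" "set us \<subseteq> {1..k}"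
    using assms(1) by (auto simp: is_path_iff_map)
  obtain as xs where us: "us = as @ x # xs" using assms(2) by (meson split_list)
  have "map p (x # xs) = drop (length as) (map p us)" by (simp add: us)
  also have "\<dots> = drop (length as) (tl us @ [v])" by (simp add: v(2))
  also have "\<dots> = xs @ [v]" by (cases as) (auto simp: us)
  finally show thesis using that v us by (auto simp: suffix_def)
qed

text \<open>From \<open>hd us\<close> on, both paths follow \<open>p\<close> until it first leaves
  \<open>{1..k}\<close>, so they share their remaining entries.\<close>

lemma path_suffix:
  assumes "is_path k p us" "is_path k p ws" "hd us \<in> set ws"
  shows "suffix us ws"
proof -
  obtain x xs where us: "us = x # xs" using assms(1) by (cases us) (auto simp: is_path_iff_map)
  then obtain v where v: "v \<notin> {1..k}" "map p (x # xs) = xs @ [v]" "set xs \<subseteq> {1..k}"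
    using assms(1) by (auto simp: is_path_iff_map)
  obtain ys w where w: "suffix (x # ys) ws" "map p (x # ys) = ys @ [w]" "w \<notin> {1..k}" "set ys \<subseteq> {1..k}"
    using path_suffix_walk[OF assms(2)] assms(3) us by (metis list.sel(1))
  have "xs = ys"
    by (rule walk_unique[OF v(2) w(2), of "- {1..k}"]) (use v w in auto)
  then show ?thesis using w(1) us by simp
qed

section \<open>Overlaps of components and uniqueness of the decomposition\<close>

text \<open>A cycle is mapped onto itself by \<open>p\<close>, whereas iterating \<open>p\<close>
  from any element of a path leads out of \<open>{1..k}\<close>.\<close>

lemma cycle_path_disjoint:
  assumes "c \<in> cycles k p" "is_path k p ws"
  shows "cycle_elems c \<inter> set ws = {}"
proof (rule ccontr)
  assume "cycle_elems c \<inter> set ws \<noteq> {}"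
  moreover obtain us where us: "c = rotation_class us" "is_cycle_seq k p us"
    using assms(1) by (auto simp: cycles_def)
  ultimately obtain x where x: "x \<in> set us" "x \<in> set ws" by auto
  have "p ` set us = set us"
    using us(2) unfolding is_cycle_seq_iff_map by (metis list.set_map set_rotate1)
  moreover obtain xs v where "map p (x # xs) = xs @ [v]" "v \<notin> {1..k}"
    using path_suffix_walk[OF assms(2) x(2)] by metis
  ultimately show False
    using walk_in_closed[of p x xs v "set us"] x(1) us(2) by (auto simp: is_cycle_seq_iff_map)
qed

text \<open>Both cycles are rotated to start at \<open>x\<close>; each then follows \<open>p\<close>
  until its first return to \<open>x\<close>.\<close>

lemma cycles_overlap_eq:
  assumes "c \<in> cycles k p" "d \<in> cycles k p" "x \<in> cycle_elems c" "x \<in> cycle_elems d"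
  shows "c = d"
proof -
  have *: "\<exists>xs. c = rotation_class (x # xs) \<and> map p (x # xs) = xs @ [x] \<and> x \<notin> set xs"
    if c: "c \<in> cycles k p" "x \<in> cycle_elems c" for c
  proof -
    obtain us where us: "c = rotation_class us" using c(1) by (auto simp: cycles_def)
    then have "x \<in> set us" using c(2) by simp
    then obtain xs where xs: "x # xs \<in> rotation_class us" by (rule rotation_class_hd)
    then have "is_cycle_seq k p (x # xs)" using cycles_is_cycle_seq c(1) us by blast
    then show ?thesis
      using us rotation_class_eq[OF xs] by (auto simp: is_cycle_seq_iff_map)
  qed
  obtain xs where xs: "c = rotation_class (x # xs)" "map p (x # xs) = xs @ [x]" "x \<notin> set xs"
    using *[OF assms(1,3)] by blast
  obtain ys where ys: "d = rotation_class (x # ys)" "map p (x # ys) = ys @ [x]" "x \<notin> set ys"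
    using *[OF assms(2,4)] by blast
  have "xs = ys" by (rule walk_unique[OF xs(2) ys(2), of "{x}"]) (use xs ys in auto)
  then show ?thesis using xs ys by simp
qed

text \<open>
  A path \<open>us\<close> of \<open>P\<close> is a suffix of some path \<open>ws\<close> of \<open>P'\<close>, which in turn is a suffix of some path
  of \<open>P\<close>; by disjointness the latter is \<open>us\<close> itself.
\<close>

lemma decomposition_subset:
  assumes "is_decomposition k p C P" "is_decomposition k p C' P'"
  shows "C \<subseteq> C'" "P \<subseteq> P'"
proof -
  have cyc: "C \<subseteq> cycles k p" "C' \<subseteq> cycles k p"
    and path: "\<And>us. us \<in> P \<Longrightarrow> is_path k p us" "\<And>us. us \<in> P' \<Longrightarrow> is_path k p us"
    and cover: "(\<Union>c\<in>C. cycle_elems c) \<union> (\<Union>us\<in>P. set us) = {1..k}"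
      "(\<Union>c\<in>C'. cycle_elems c) \<union> (\<Union>us\<in>P'. set us) = {1..k}"
    and disj: "disjoint_family_on set P"
    using assms by (auto simp: is_decomposition_def)
  \<comment> \<open>Kept general in \<open>D\<close> and \<open>Q\<close> because it is applied to
    both decompositions.\<close>
  have other: "\<exists>ws\<in>Q. hd us \<in> set ws"
    if "is_path k p us" "D \<subseteq> cycles k p" "(\<Union>c\<in>D. cycle_elems c) \<union> (\<Union>us\<in>Q. set us) = {1..k}"
    for us D Q
  proof -
    have "hd us \<in> set us" "set us \<subseteq> {1..k}" using that(1) by (auto simp: is_path_iff_map)
    then show ?thesis using that cycle_path_disjoint by blast
  qed
  show "C \<subseteq> C'"
  proof
    fix c assume c: "c \<in> C"
    then have cc: "c \<in> cycles k p" using cyc by auto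
    then obtain x where x: "x \<in> cycle_elems c"
      using cycles_subset_cyclic_seqs cycle_elems_nonempty by blast
    then have "x \<in> {1..k}" using c cover(1) by blast
    \<comment> \<open>Paths of \<open>P'\<close> avoid the cycle \<open>c\<close>, so only a cycle
      of \<open>C'\<close> can cover \<open>x\<close>, and overlapping cycles coincide.\<close>
    moreover have "x \<notin> set us" if "us \<in> P'" for us
      using x cycle_path_disjoint[OF cc path(2)[OF that]] by auto
    ultimately obtain d where "d \<in> C'" "x \<in> cycle_elems d" using cover(2) by blast
    then show "c \<in> C'" using cycles_overlap_eq[OF cc _ x] cyc(2) by blast
  qed
  show "P \<subseteq> P'"
  proof
    fix us assume us: "us \<in> P"
    obtain ws where ws: "ws \<in> P'" "suffix us ws"
      using other[OF path(1)[OF us] cyc(2) cover(2)] path path_suffix us by metis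
    obtain zs where zs: "zs \<in> P" "suffix ws zs"
      using other[OF path(2)[OF ws(1)] cyc(1) cover(1)] path path_suffix ws by metis
    have "suffix us zs" using ws zs suffix_order.trans by blast
    then have "set us \<subseteq> set zs" by (simp add: set_mono_suffix)
    moreover have "us \<noteq> []" using path(1)[OF us] by (simp add: is_path_iff_map)
    ultimately have "us = zs"
      using disj us zs(1) unfolding disjoint_family_on_def by (metis inf.absorb1 set_empty2)
    then show "us \<in> P'" using ws zs suffix_order.antisym by blast
  qed
qed

lemma decomposition_unique:
  assumes "is_decomposition k p C P" "is_decomposition k p C' P'"
  shows "C = C'" "P = P'"
  using decomposition_subset[OF assms] decomposition_subset[OF assms(2,1)] by auto

section \<open>Maps realising a family of cycles and paths\<close>

text \<open>Each pair \<open>(us, ws)\<close> prescribes values along \<open>us\<close>. Disjoint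
  domains make the prescription single-valued and disjoint ranges make it injective.\<close>

lemma ex_inj_map_lists:
  assumes len: "\<And>us ws. (us, ws) \<in> L \<Longrightarrow> length us = length ws \<and> distinct us \<and> distinct ws"
    and dom: "\<And>us ws us' ws'. (us, ws) \<in> L \<Longrightarrow> (us', ws') \<in> L \<Longrightarrow> set us \<inter> set us' \<noteq> {} \<Longrightarrow>
      us = us' \<and> ws = ws'"
    and ran: "\<And>us ws us' ws'. (us, ws) \<in> L \<Longrightarrow> (us', ws') \<in> L \<Longrightarrow> set ws \<inter> set ws' \<noteq> {} \<Longrightarrow>
      us = us' \<and> ws = ws'"
  obtains p where "p \<in> extensional (\<Union>(us, ws)\<in>L. set us)" "inj_on p (\<Union>(us, ws)\<in>L. set us)"
    "\<And>us ws. (us, ws) \<in> L \<Longrightarrow> map p us = ws"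
proof -
  define D where "D = (\<Union>(us, ws)\<in>L. set us)"
  \<comment> \<open>\<open>G\<close> is the graph of the map to be built.\<close>
  define G where "G x y \<longleftrightarrow> (\<exists>us ws t. (us, ws) \<in> L \<and> t < length us \<and> x = us ! t \<and> y = ws ! t)" for x y
  have func: "y = y'" if "G x y" "G x y'" for x y y'
  proof -
    obtain us ws t us' ws' t' where *: "(us, ws) \<in> L" "t < length us" "x = us ! t" "y = ws ! t"
      "(us', ws') \<in> L" "t' < length us'" "x = us' ! t'" "y' = ws' ! t'"
      using \<open>G x y\<close> \<open>G x y'\<close> unfolding G_def by blast
    then have "x \<in> set us" "x \<in> set us'" by (metis nth_mem)+
    then have "us = us' \<and> ws = ws'" using dom * by blast
    then show ?thesis using * len[OF *(1)] by (metis nth_eq_iff_index_eq)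
  qed
  have inj: "x = x'" if "G x y" "G x' y" for x x' y
  proof -
    obtain us ws t us' ws' t' where *: "(us, ws) \<in> L" "t < length us" "x = us ! t" "y = ws ! t"
      "(us', ws') \<in> L" "t' < length us'" "x' = us' ! t'" "y = ws' ! t'"
      using \<open>G x y\<close> \<open>G x' y\<close> unfolding G_def by blast
    then have "y \<in> set ws" "y \<in> set ws'" using len by (metis nth_mem)+
    then have "us = us' \<and> ws = ws'" using ran * by blast
    then show ?thesis using * len[OF *(1)] by (metis nth_eq_iff_index_eq)
  qed
  have ex: "\<exists>y. G x y" if "x \<in> D" for x
    using that unfolding D_def G_def by (fastforce simp: in_set_conv_nth)
  define p where "p = restrict (\<lambda>x. THE y. G x y) D"
  have p: "p x = y" if "G x y" for x y
  proof -
    have "x \<in> D" using that unfolding G_def D_def by force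
    then show ?thesis using that func by (auto simp: p_def)
  qed
  show thesis
  proof
    show "p \<in> extensional (\<Union>(us, ws)\<in>L. set us)" by (simp add: p_def D_def)
    show "inj_on p (\<Union>(us, ws)\<in>L. set us)"
      unfolding D_def[symmetric] using ex p inj by (metis inj_onI)
    show "map p us = ws" if L: "(us, ws) \<in> L" for us ws
    proof -
      have "G (us ! t) (ws ! t)" if "t < length us" for t
        using L that unfolding G_def by blast
      then show ?thesis using len[OF L] p by (intro nth_equalityI) auto
    qed
  qed
qed

section \<open>Correspondence between maps and configurations\<close>

text \<open>The matching is a relation; each side is shown to have a partner, and a partner
  determines its counterpart.\<close>

definition realises :: "nat \<Rightarrow> (nat \<Rightarrow> nat) \<Rightarrow> nat list set set \<times> (nat list \<times> nat) set \<Rightarrow> bool" where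
  "realises k p x \<longleftrightarrow>
    is_decomposition k p (fst x) (fst ` snd x) \<and> (\<forall>(us, v)\<in>snd x. p (last us) = v)"

text \<open>Each element of \<open>{1..k}\<close> lies on a component, where its image is the next
  entry, cyclically on a cycle, or the recorded end value.\<close>

lemma realises_determines_map:
  assumes "realises k p x" "realises k q x" "p \<in> extensional {1..k}" "q \<in> extensional {1..k}"
  shows "p = q"
proof (rule extensionalityI[OF assms(3,4)])
  fix y assume y: "y \<in> {1..k}"
  have dec: "is_decomposition k p (fst x) (fst ` snd x)" "is_decomposition k q (fst x) (fst ` snd x)"
    and last: "\<forall>(us, v)\<in>snd x. p (last us) = v" "\<forall>(us, v)\<in>snd x. q (last us) = v"
    using assms by (auto simp: realises_def)
  have "y \<in> (\<Union>c\<in>fst x. cycle_elems c) \<union> (\<Union>us\<in>fst ` snd x. set us)"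
    using y dec(1) unfolding is_decomposition_def by blast
  then consider c where "c \<in> fst x" "y \<in> cycle_elems c"
    | r where "r \<in> snd x" "y \<in> set (fst r)"
    by blast
  then show "p y = q y"
  proof cases
    case 1
    then obtain us where us: "us \<in> c" "y \<in> set us" by (auto simp: cycle_elems_def)
    have "c \<in> cycles k p" "c \<in> cycles k q" using dec 1 by (auto simp: is_decomposition_def)
    then have "map p us = map q us"
      using us(1) cycles_is_cycle_seq unfolding is_cycle_seq_iff_map by metis
    then show ?thesis using us(2) by simp
  next
    case 2
    then obtain us v where uv: "(us, v) \<in> snd x" "y \<in> set us" by (metis prod.collapse)
    then have "us \<in> fst ` snd x" by force
    then have "is_path k p us" "is_path k q us" "p (last us) = q (last us)"
      using dec last uv(1) by (auto simp: is_decomposition_def)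
    then have "map p us = map q us" by (metis is_chain_iff_map is_path_def)
    then show ?thesis using uv(2) by simp
  qed
qed

text \<open>The decomposition is unique, and the end values are read off from \<open>p\<close> at
  the last elements.\<close>

lemma realises_determines_config:
  assumes "realises k p x" "realises k p y"
  shows "x = y"
proof -
  have "snd z = (\<lambda>us. (us, p (last us))) ` fst ` snd z" if "realises k p z" for z
    using that by (force simp: realises_def image_iff)
  note snd = this[OF assms(1)] this[OF assms(2)]
  have "is_decomposition k p (fst x) (fst ` snd x)" "is_decomposition k p (fst y) (fst ` snd y)"
    using assms by (simp_all add: realises_def)
  note eq = decomposition_unique[OF this]
  have "snd x = snd y" using snd eq(2) by argo
  then show ?thesis using eq(1) by (simp add: prod_eq_iff)
qed

lemma ex_realised_config:
  assumes p: "p \<in> k_perms k n" and t: "has_cycle_type k p a b"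
  shows "\<exists>x\<in>configs {1..k} {1..k} {k+1..n} a b. realises k p x"
proof -
  obtain C P where d: "is_decomposition k p C P"
    and a: "\<forall>i\<in>{1..k}. card {c \<in> C. cycle_has_length c i} = a i"
    and b: "\<forall>i\<in>{1..k}. card {us \<in> P. length us = i} = b i"
    using t by (auto simp: has_cycle_type_def)
  let ?Q = "(\<lambda>us. (us, p (last us))) ` P"
  have fstQ: "fst ` ?Q = P" by (simp add: image_image)
  have path: "is_path k p us" if "us \<in> P" for us using d that by (auto simp: is_decomposition_def)
  have lastS: "last us \<in> {1..k} \<and> last us \<in> set us" if "us \<in> P" for us
    using path[OF that] last_in_set[of us] unfolding is_path_iff_map by blast
  have "disjoint_family_on set P" using d by (simp add: is_decomposition_def)
  then have disj: "us = ws" if "us \<in> P" "ws \<in> P" "x \<in> set us" "x \<in> set ws" for us ws x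
    using that unfolding disjoint_family_on_def by blast
  have "(C, ?Q) \<in> configs {1..k} {1..k} {k+1..n} a b"
    unfolding configs_def
  proof (clarify, intro conjI)
    show "C \<subseteq> cyclic_seqs" using d cycles_subset_cyclic_seqs by (auto simp: is_decomposition_def)
    show "?Q \<subseteq> ended_seqs {k+1..n}"
    proof clarsimp
      fix us assume us: "us \<in> P"
      have "p (last us) \<in> {1..n}" using p lastS[OF us] by (auto simp: k_perms_def)
      moreover have "p (last us) \<notin> {1..k}" using path[OF us] by (simp add: is_path_def)
      ultimately show "(us, p (last us)) \<in> ended_seqs {Suc k..n}"
        using path[OF us] by (auto simp: ended_seqs_def is_path_iff_map)
    qed
    show "disjoint_family_on cycle_elems C"
      "(\<Union>c\<in>C. cycle_elems c) \<inter> (\<Union>q\<in>?Q. set (fst q)) = {}"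
      "(\<Union>c\<in>C. cycle_elems c) \<union> (\<Union>q\<in>?Q. set (fst q)) = {1..k}"
      using d by (auto simp: is_decomposition_def)
    show "disjoint_family_on (\<lambda>q. set (fst q)) ?Q"
      using disj by (fastforce simp: disjoint_family_on_def)
    \<comment> \<open>Injectivity of \<open>p\<close> enters here: equal end values force equal last
      elements, and disjoint paths sharing an element coincide.\<close>
    show "inj_on snd ?Q"
    proof (rule inj_onI, clarsimp)
      fix us ws assume *: "us \<in> P" "ws \<in> P" "p (last us) = p (last ws)"
      then have "last us = last ws"
        using p lastS unfolding k_perms_def inj_on_def by blast
      then show "us = ws" using disj * lastS by metis
    qed
    have "{q \<in> ?Q. length (fst q) = i} = (\<lambda>us. (us, p (last us))) ` {us \<in> P. length us = i}" for i
      by auto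
    then have "card {q \<in> ?Q. length (fst q) = i} = card {us \<in> P. length us = i}" for i
      by (simp add: card_image inj_on_def)
    then show "\<forall>i\<in>{1..k}. card {c \<in> C. cycle_has_length c i} = a i \<and>
        card {q \<in> ?Q. length (fst q) = i} = b i"
      using a b by simp
  qed
  moreover have "realises k p (C, ?Q)" using d fstQ by (auto simp: realises_def)
  ultimately show ?thesis by blast
qed

text \<open>The map is prescribed along one representative of each cycle and along each path, then
  assembled by \<open>ex_inj_map_lists\<close>.\<close>

lemma ex_realising_map:
  assumes "k \<le> n" and x: "x \<in> configs {1..k} {1..k} {k+1..n} a b"
  shows "\<exists>p\<in>{p \<in> k_perms k n. has_cycle_type k p a b}. realises k p x"
proof -
  obtain C P where xCP: "x = (C, P)" by (cases x)
  have C: "C \<subseteq> cyclic_seqs" and P: "P \<subseteq> ended_seqs {k+1..n}"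
    and dC: "disjoint_family_on cycle_elems C" and dP: "disjoint_family_on (\<lambda>q. set (fst q)) P"
    and iP: "inj_on snd P"
    and dCP: "(\<Union>c\<in>C. cycle_elems c) \<inter> (\<Union>q\<in>P. set (fst q)) = {}"
    and cov: "(\<Union>c\<in>C. cycle_elems c) \<union> (\<Union>q\<in>P. set (fst q)) = {1..k}"
    and cnt: "\<forall>i\<in>{1..k}. card {c \<in> C. cycle_has_length c i} = a i \<and> card {q \<in> P. length (fst q) = i} = b i"
    using x by (auto simp: configs_def xCP)
  have "\<forall>c\<in>C. \<exists>us. c = rotation_class us \<and> us \<noteq> [] \<and> distinct us"
    using C by (auto simp: cyclic_seqs_def)
  then obtain rep where rep: "\<And>c. c \<in> C \<Longrightarrow> c = rotation_class (rep c) \<and> rep c \<noteq> [] \<and> distinct (rep c)"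
    by metis
  then have elems: "set (rep c) = cycle_elems c" if "c \<in> C" for c
    using that cycle_elems_rotation_class by metis
  \<comment> \<open>The second lists are the images demanded by \<open>is_cycle_seq_iff_map\<close>
    and \<open>is_path_iff_map\<close>.\<close>
  let ?L1 = "(\<lambda>c. (rep c, rotate1 (rep c))) ` C" and ?L2 = "(\<lambda>(us, v). (us, tl us @ [v])) ` P"
  have P_D: "us \<noteq> [] \<and> distinct us \<and> v \<in> {k+1..n} \<and> set us \<subseteq> {1..k}" if "(us, v) \<in> P" for us v
    using that P cov by (force simp: ended_seqs_def)
  have C_eq: "c = d" if "c \<in> C" "d \<in> C" "cycle_elems c \<inter> cycle_elems d \<noteq> {}" for c d
    using that dC by (auto simp: disjoint_family_on_def)
  have P_eq: "us = us' \<and> v = v'"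
    if "(us, v) \<in> P" "(us', v') \<in> P" "set us \<inter> set us' \<noteq> {} \<or> v = v'" for us v us' v'
    using that dP iP by (fastforce simp: disjoint_family_on_def inj_on_def)
  have CP: "cycle_elems c \<inter> set us = {}" "v \<notin> cycle_elems c" if "c \<in> C" "(us, v) \<in> P" for c us v
  proof -
    have "set us \<subseteq> (\<Union>q\<in>P. set (fst q))" using that(2) by force
    then show "cycle_elems c \<inter> set us = {}" using dCP that(1) by blast
    have "cycle_elems c \<subseteq> {1..k}" using cov that(1) by blast
    then show "v \<notin> cycle_elems c" using P_D[OF that(2)] by auto
  qed
  have ran_sub: "set (tl us @ [v]) \<subseteq> insert v (set us)" for us :: "nat list" and v
    by (cases us) auto
  have domL: "(\<Union>(us, ws)\<in>?L1 \<union> ?L2. set us) = {1..k}"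
    unfolding cov[symmetric] by (simp add: UN_Un case_prod_beta elems)
  have L_len: "length us = length ws \<and> distinct us \<and> distinct ws" if "(us, ws) \<in> ?L1 \<union> ?L2" for us ws
    using that
  proof
    assume "(us, ws) \<in> ?L2"
    then obtain v where v: "(us, v) \<in> P" "ws = tl us @ [v]" by auto
    have "v \<notin> set (tl us)" using P_D[OF v(1)] by (cases us) auto
    then show ?thesis using P_D[OF v(1)] v(2) by (auto simp: distinct_tl)
  qed (use rep in auto)
  have L_cases: thesis
    if "(us, ws) \<in> ?L1 \<union> ?L2"
      "\<And>c. c \<in> C \<Longrightarrow> us = rep c \<Longrightarrow> ws = rotate1 (rep c) \<Longrightarrow> thesis"
      "\<And>v. (us, v) \<in> P \<Longrightarrow> ws = tl us @ [v] \<Longrightarrow> thesis"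
    for us ws thesis
    using that by auto
  have L_dom: "us = us' \<and> ws = ws'"
    if L: "(us, ws) \<in> ?L1 \<union> ?L2" "(us', ws') \<in> ?L1 \<union> ?L2" and overlap: "set us \<inter> set us' \<noteq> {}"
    for us ws us' ws'
  proof (cases rule: L_cases[OF L(1)]; cases rule: L_cases[OF L(2)])
    fix c d assume "c \<in> C" "us = rep c" "ws = rotate1 (rep c)" "d \<in> C" "us' = rep d" "ws' = rotate1 (rep d)"
    then show ?thesis using overlap C_eq[of c d] elems by auto
  next
    fix v v' assume "(us, v) \<in> P" "ws = tl us @ [v]" "(us', v') \<in> P" "ws' = tl us' @ [v']"
    then show ?thesis using overlap P_eq[of us v us' v'] by auto
  qed (use overlap CP elems in auto)
  have L_ran: "us = us' \<and> ws = ws'"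
    if L: "(us, ws) \<in> ?L1 \<union> ?L2" "(us', ws') \<in> ?L1 \<union> ?L2" and overlap: "set ws \<inter> set ws' \<noteq> {}"
    for us ws us' ws'
  proof (cases rule: L_cases[OF L(1)]; cases rule: L_cases[OF L(2)])
    fix c d assume "c \<in> C" "us = rep c" "ws = rotate1 (rep c)" "d \<in> C" "us' = rep d" "ws' = rotate1 (rep d)"
    then show ?thesis using overlap C_eq[of c d] elems by auto
  next
    fix c v assume "c \<in> C" "us = rep c" "ws = rotate1 (rep c)" "(us', v) \<in> P" "ws' = tl us' @ [v]"
    then show ?thesis using overlap CP[of c us' v] elems ran_sub[of us' v] by auto
  next
    fix v c assume "(us, v) \<in> P" "ws = tl us @ [v]" "c \<in> C" "us' = rep c" "ws' = rotate1 (rep c)"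
    then show ?thesis using overlap CP[of c us v] elems ran_sub[of us v] by auto
  next
    fix v v' assume P4: "(us, v) \<in> P" "ws = tl us @ [v]" "(us', v') \<in> P" "ws' = tl us' @ [v']"
    \<comment> \<open>End values exceed \<open>k\<close>, so images of two paths can overlap only in
      an element common to both lists or in a common end value.\<close>
    have "v \<notin> set us'" "v' \<notin> set us" using P_D[OF P4(1)] P_D[OF P4(3)] by auto
    then have "set us \<inter> set us' \<noteq> {} \<or> v = v'"
      using overlap P4(2,4) ran_sub[of us v] ran_sub[of us' v'] by auto
    then show ?thesis using P_eq[OF P4(1,3)] P4 by auto
  qed
  obtain p where p: "p \<in> extensional {1..k}" "inj_on p {1..k}"
    "\<And>us ws. (us, ws) \<in> ?L1 \<union> ?L2 \<Longrightarrow> map p us = ws"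
    using ex_inj_map_lists[of "?L1 \<union> ?L2", OF L_len L_dom L_ran] unfolding domL by blast
  have cyc: "is_cycle_seq k p (rep c)" if "c \<in> C" for c
    using that p(3)[of "rep c" "rotate1 (rep c)"] rep[OF that] elems[OF that] cov
    by (auto simp: is_cycle_seq_iff_map)
  have map_path: "map p us = tl us @ [v]" if "(us, v) \<in> P" for us v
    using p(3) that by force
  have path: "is_path k p us \<and> p (last us) = v" if "(us, v) \<in> P" for us v
  proof
    show "is_path k p us"
      using P_D[OF that] map_path[OF that] by (auto simp: is_path_iff_map intro!: exI[of _ v])
    show "p (last us) = v"
      using P_D[OF that] map_path[OF that] by (metis last_map last_snoc)
  qed
  have "p y \<in> {1..n}" if y: "y \<in> {1..k}" for y
  proof -
    consider c where "c \<in> C" "y \<in> set (rep c)" | us v where "(us, v) \<in> P" "y \<in> set us"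
      using y elems unfolding cov[symmetric] by force
    then show ?thesis
    proof cases
      case 1
      then have "p y \<in> set (map p (rep c))" by simp
      then have "p y \<in> {1..k}" using cyc[OF 1(1)] unfolding is_cycle_seq_iff_map by auto
      then show ?thesis using \<open>k \<le> n\<close> by auto
    next
      case 2
      then have "p y \<in> set (map p us)" by simp
      then have "p y \<in> insert v (set us)" using map_path[OF 2(1)] ran_sub by auto
      then show ?thesis using P_D[OF 2(1)] \<open>k \<le> n\<close> by auto
    qed
  qed
  then have kp: "p \<in> k_perms k n"
    using p(1,2) by (auto simp: k_perms_def PiE_def)
  \<comment> \<open>A nonempty list overlaps itself, so it occurs with only one end value; counting
    paths thus agrees with counting pairs.\<close>
  have inj: "inj_on fst P" using P_eq P_D by (fastforce simp: inj_on_def)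
  have dec: "is_decomposition k p C (fst ` P)"
    unfolding is_decomposition_def
  proof (intro conjI)
    show "C \<subseteq> cycles k p" using cyc rep by (fastforce simp: cycles_def)
    show "fst ` P \<subseteq> {us. is_path k p us}" using path by auto
    show "disjoint_family_on set (fst ` P)" using P_eq unfolding disjoint_family_on_def by force
  qed (use dC dCP cov in auto)
  have "card {us \<in> fst ` P. length us = i} = card {q \<in> P. length (fst q) = i}" for i
  proof -
    have "{us \<in> fst ` P. length us = i} = fst ` {q \<in> P. length (fst q) = i}" by auto
    then show ?thesis using inj by (simp add: card_image inj_on_subset)
  qed
  then have "has_cycle_type k p a b" using dec cnt
    unfolding has_cycle_type_def by (intro exI[of _ C] exI[of _ "fst ` P"]) simp
  moreover have "realises k p x" using dec path by (auto simp: realises_def xCP)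
  ultimately show ?thesis using kp by blast
qed

text \<open>The relation \<open>realises\<close> yields one inequality in each direction, with no
  explicit bijection.\<close>

lemma card_eq_configs:
  assumes "k \<le> n"
  shows "card {p \<in> k_perms k n. has_cycle_type k p a b} =
    card (configs {1..k} {1..k} {k+1..n} a b)" (is "card ?A = card ?B")
proof (rule antisym)
  have "finite (k_perms k n)"
    by (rule finite_subset[of _ "{1..k} \<rightarrow>\<^sub>E {1..n}"]) (auto simp: k_perms_def intro: finite_PiE)
  then have "finite ?A" by simp
  show "card ?A \<le> card ?B"
  proof (rule card_le_if_inj_on_rel[where r="realises k"])
    show "finite ?B" by (simp add: finite_configs)
    show "\<And>p. p \<in> ?A \<Longrightarrow> \<exists>x. x \<in> ?B \<and> realises k p x" using ex_realised_config by blast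
    show "p = q" if "p \<in> ?A" "q \<in> ?A" "x \<in> ?B" "realises k p x" "realises k q x" for p q x
      by (rule realises_determines_map[OF that(4,5)]) (use that in \<open>auto simp: k_perms_def PiE_def\<close>)
  qed
  show "card ?B \<le> card ?A"
  proof (rule card_le_if_inj_on_rel[where r="\<lambda>x p. realises k p x", OF \<open>finite ?A\<close>])
    show "\<And>x. x \<in> ?B \<Longrightarrow> \<exists>p. p \<in> ?A \<and> realises k p x" using ex_realising_map[OF assms] by blast
  qed (rule realises_determines_config)
qed

theorem theorem4:
  fixes k n :: nat and a b :: "nat \<Rightarrow> nat"
  assumes "1 \<le> k" and "k \<le> n"
    and "(\<Sum>i=1..k. i * (a i + b i)) = k"
  shows "real (card {p \<in> k_perms k n. has_cycle_type k p a b}) =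
    fact k / (\<Prod>i=1..k. real i ^ a i * fact (a i) * fact (b i)) *
    falling_fact (real n - real k) (\<Sum>i=1..k. b i)"
  \<comment> \<open>The pool \<open>{k+1..n}\<close> has \<open>n - k\<close> elements, and by
    \<open>k \<le> n\<close> this difference agrees with the real one.\<close>
  using card_configs[of "{1..k}" "{1..k}" "{k+1..n}" a b] assms
  by (simp add: card_eq_configs of_nat_diff)

end
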